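(* Let $s\in\mathbb{N}$ and $\beta\in\mathbb{R}^+$, and let $\mathcal{G}$ be an infinite class of $(s,\beta)$-expanders. Then the reduced bandwidth $\widetilde{\mathrm{bw}}$ is unbounded on $\mathcal{G}$.
   Context: A graph $G$ is an $(s,\beta)$-expander if $G$ contains no $K_{s,s}$ subgraph and for every $S\subseteq V(G)$ with $|S|\le |V(G)|/2$ we have $|N_G(S)|\ge\beta|S|$, where $N_G(S)$ is the set of vertices outside $S$ with a neighbour in $S$. A trigraph is a triple $(V,E,R)$ with $V$ finite and $E,R$ disjoint subsets of $\binom V2$ (black and red edges); its red graph is $(V,R)$. For distinct $u,v$, $G/u,v$ replaces $u,v$ by a new vertex $w$, keeping other pairs unchanged, where for each other vertex $x$: $wx$ is black iff $ux,vx$ are both black, a non-edge iff neither $ux$ nor $vx$ is an edge, and red otherwise. A reduction sequence of an $n$-vertex trigraph $G_n$ is $G_n,\dots,G_1$ with $G_{i-1}=G_i/u,v$ and $|V(G_1)|=1$; a graph is the trigraph with no red edges. The reduced bandwidth $\widetilde{\mathrm{bw}}(G)$ is the minimum $k\in\mathbb{N}$ such that some reduction sequence of $G$ has all red graphs of bandwidth at most $k$ (bandwidth: minimum $k$ such that some vertex ordering $v_1,\dots,v_n$ has $|i-j|\le k$ for every edge $v_iv_j$). *)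

theory Defs
  imports Complex_Main "HOL-Library.Ramsey"
begin

text \<open>The set of two-element subsets of \<open>V\<close> is \<^term>\<open>nsets V 2\<close>.\<close>

record 'a graph =
  verts :: "'a set"
  edges :: "'a set set"

definition simple_graph :: "'a graph \<Rightarrow> bool" where
  "simple_graph G \<longleftrightarrow> finite (verts G) \<and> edges G \<subseteq> nsets (verts G) 2"

definition isomorphic :: "'a graph \<Rightarrow> 'a graph \<Rightarrow> bool" where
  "isomorphic G H \<longleftrightarrow>
     (\<exists>f. bij_betw f (verts G) (verts H) \<and> edges H = (`) f ` edges G)"

text \<open>
  A class of graphs is a set of concrete graphs, and its size is counted up to isomorphism
  (otherwise the copies of a single graph would form an infinite class).
\<close>

definition iso_rel :: "'a graph set \<Rightarrow> ('a graph \<times> 'a graph) set" where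
  "iso_rel \<G> = {(G, H). G \<in> \<G> \<and> H \<in> \<G> \<and> isomorphic G H}"

definition infinite_class :: "'a graph set \<Rightarrow> bool" where
  "infinite_class \<G> \<longleftrightarrow> infinite (\<G> // iso_rel \<G>)"

definition neighbours :: "'a graph \<Rightarrow> 'a set \<Rightarrow> 'a set" where
  "neighbours G S = {v \<in> verts G - S. \<exists>u\<in>S. {u, v} \<in> edges G}"

definition contains_Kss :: "'a graph \<Rightarrow> nat \<Rightarrow> bool" where
  "contains_Kss G s \<longleftrightarrow>
     (\<exists>A B. A \<subseteq> verts G \<and> B \<subseteq> verts G \<and> A \<inter> B = {} \<and> card A = s \<and> card B = s
        \<and> (\<forall>a\<in>A. \<forall>b\<in>B. {a, b} \<in> edges G))"

definition expander :: "nat \<Rightarrow> real \<Rightarrow> 'a graph \<Rightarrow> bool" where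
  "expander s \<beta> G \<longleftrightarrow>
     \<not> contains_Kss G s \<and>
     (\<forall>S\<subseteq>verts G. real (card S) \<le> real (card (verts G)) / 2 \<longrightarrow>
        real (card (neighbours G S)) \<ge> \<beta> * real (card S))"

text \<open>An ordering of the vertices is a duplicate-free list enumerating them.\<close>

definition ordering_width_le :: "'a graph \<Rightarrow> 'a list \<Rightarrow> nat \<Rightarrow> bool" where
  "ordering_width_le G vs k \<longleftrightarrow>
     (\<forall>i<length vs. \<forall>j<length vs. {vs ! i, vs ! j} \<in> edges G \<longrightarrow> \<bar>int i - int j\<bar> \<le> int k)"

definition bandwidth :: "'a graph \<Rightarrow> nat" where
  "bandwidth G =
     (LEAST k. \<exists>vs. distinct vs \<and> set vs = verts G \<and> ordering_width_le G vs k)"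

record 'a trigraph =
  tverts :: "'a set"
  black :: "'a set set"
  red :: "'a set set"

definition wf_trigraph :: "'a trigraph \<Rightarrow> bool" where
  "wf_trigraph T \<longleftrightarrow>
     finite (tverts T) \<and> black T \<subseteq> nsets (tverts T) 2 \<and> red T \<subseteq> nsets (tverts T) 2
     \<and> black T \<inter> red T = {}"

definition red_graph :: "'a trigraph \<Rightarrow> 'a graph" where
  "red_graph T = \<lparr>verts = tverts T, edges = red T\<rparr>"

definition trigraph_of :: "'a graph \<Rightarrow> 'a trigraph" where
  "trigraph_of G = \<lparr>tverts = verts G, black = edges G, red = {}\<rparr>"

text \<open>\<open>contract T u v w\<close> is \<open>T/u,v\<close> with the new vertex named \<open>w\<close>.\<close>

definition contract :: "'a trigraph \<Rightarrow> 'a \<Rightarrow> 'a \<Rightarrow> 'a \<Rightarrow> 'a trigraph" where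
  "contract T u v w =
     (let X = tverts T - {u, v}; E = black T \<union> red T in
      \<lparr>tverts = insert w X,
       black = (black T \<inter> nsets X 2)
         \<union> {{w, x} | x. x \<in> X \<and> {u, x} \<in> black T \<and> {v, x} \<in> black T},
       red = (red T \<inter> nsets X 2)
         \<union> {{w, x} | x. x \<in> X \<and> \<not> ({u, x} \<in> black T \<and> {v, x} \<in> black T)
                        \<and> \<not> ({u, x} \<notin> E \<and> {v, x} \<notin> E)}\<rparr>)"

text \<open>
  The name of the new vertex only has to differ from the remaining vertices. It may reuse
  \<open>u\<close> or \<open>v\<close>, which changes the result only up to isomorphism and ensures that a
  contraction exists even if every element of the type is a vertex.
\<close>

definition contraction :: "'a trigraph \<Rightarrow> 'a trigraph \<Rightarrow> bool" where
  "contraction T T' \<longleftrightarrow>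
     (\<exists>u\<in>tverts T. \<exists>v\<in>tverts T. \<exists>w. u \<noteq> v \<and> w \<notin> tverts T - {u, v} \<and> T' = contract T u v w)"

text \<open>
  The sequence \<open>G\<^sub>n, \<dots>, G\<^sub>1\<close> is represented by a function of the index, of which only the
  values at \<open>1, \<dots>, n\<close> matter.
\<close>

definition reduction_sequence :: "'a trigraph \<Rightarrow> (nat \<Rightarrow> 'a trigraph) \<Rightarrow> bool" where
  "reduction_sequence T Gs \<longleftrightarrow>
     Gs (card (tverts T)) = T \<and>
     (\<forall>i\<in>{2..card (tverts T)}. contraction (Gs i) (Gs (i - 1))) \<and>
     card (tverts (Gs 1)) = 1"

text \<open>For the graph without vertices no index is relevant, and the value is 0.\<close>

definition reduced_bandwidth :: "'a graph \<Rightarrow> nat" where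
  "reduced_bandwidth G =
     (LEAST k. \<exists>Gs. reduction_sequence (trigraph_of G) Gs \<and>
        (\<forall>i\<in>{1..card (verts G)}. bandwidth (red_graph (Gs i)) \<le> k))"

lemma wf_trigraph_of: "simple_graph G \<Longrightarrow> wf_trigraph (trigraph_of G)"
  by (simp add: simple_graph_def wf_trigraph_def trigraph_of_def)

lemma wf_contraction:
  assumes T: "wf_trigraph T" and c: "contraction T T'"
  shows "wf_trigraph T' \<and> Suc (card (tverts T')) = card (tverts T)"
proof -
  obtain u v w where uv: "u \<in> tverts T" "v \<in> tverts T" "u \<noteq> v" "w \<notin> tverts T - {u, v}"
    and T': "T' = contract T u v w"
    using c by (auto simp: contraction_def)
  define X where "X = tverts T - {u, v}"
  have X: "w \<notin> X" "finite X" and "black T \<inter> red T = {}" "finite (tverts T)"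
    using uv T by (auto simp: X_def wf_trigraph_def)
  have new: "{w, x} \<in> nsets (insert w X) 2" if "x \<in> X" for x
    using that X by (auto simp: nsets_def card_insert_if)
  have old: "nsets X 2 \<subseteq> nsets (insert w X) 2"
    by (rule nsets_mono) auto
  have sep: "{w, x} \<notin> nsets X 2" for x
    using X by (auto simp: nsets_def)
  have eq: "{w, x} = {w, y} \<longleftrightarrow> x = y" for x y
    by (auto simp: doubleton_eq_iff)
  have wf: "wf_trigraph T'"
    unfolding wf_trigraph_def T' contract_def Let_def X_def[symmetric]
    using X new old sep \<open>black T \<inter> red T = {}\<close> by (auto simp: eq)
  have c2: "card {u, v} = 2"
    using uv(3) by simp
  have "card {u, v} \<le> card (tverts T)"
    using uv(1,2) \<open>finite (tverts T)\<close> by (intro card_mono) auto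
  with c2 have "card X + 2 = card (tverts T)"
    using uv(1,2) \<open>finite (tverts T)\<close> card_Diff_subset[of "{u, v}" "tverts T"] c2
    by (simp add: X_def)
  then have "Suc (card (tverts T')) = card (tverts T)"
    using X by (simp add: T' contract_def Let_def X_def[symmetric])
  with wf show ?thesis by blast
qed

lemma ex_reduction_sequence:
  assumes "wf_trigraph T" "tverts T \<noteq> {}"
  shows "\<exists>Gs. reduction_sequence T Gs"
  using assms
proof (induction "card (tverts T)" arbitrary: T)
  case 0
  then show ?case by (auto simp: wf_trigraph_def)
next
  case (Suc n)
  show ?case
  proof (cases "n = 0")
    case True
    then have "reduction_sequence T (\<lambda>_. T)"
      using Suc.hyps(2) by (auto simp: reduction_sequence_def)
    then show ?thesis by blast
  next
    case False
    then obtain u v where uv: "u \<in> tverts T" "v \<in> tverts T" "u \<noteq> v"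
      using Suc.hyps(2) card_le_Suc0_iff_eq[of "tverts T"] Suc.prems(1)
      by (auto simp: wf_trigraph_def)
    define T' where "T' = contract T u v u"
    have c: "contraction T T'"
      using uv by (auto simp: contraction_def T'_def)
    then have T': "wf_trigraph T'" "card (tverts T') = n"
      using wf_contraction[OF Suc.prems(1) c] Suc.hyps(2) by auto
    then have "tverts T' \<noteq> {}"
      using False by auto
    then obtain Gs where Gs: "reduction_sequence T' Gs"
      using Suc.hyps(1) T' by blast
    have "reduction_sequence T (Gs(Suc n := T))"
      using Gs T' c False Suc.hyps(2)[symmetric] by (auto simp: reduction_sequence_def le_Suc_eq)
    then show ?thesis by blast
  qed
qed

end

theory Submission
  imports Defs "HOL-Real_Asymp.Real_Asymp"
begin

text \<open>
  Suppose that a large expander has a reduction sequence whose red graphs have bandwidth at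
  most \<open>k\<close>. The vertices of each trigraph in the sequence stand for the bags of a partition of
  the vertices of \<open>G\<close>. Stop at the first trigraph with a bag of size at least a suitable
  constant \<open>m\<close>; then every bag has size at most \<open>2m\<close>. Starting from the large bag, expansion
  makes the union of the bags of size at least \<open>s\<close> in the window of radius \<open>k r\<close> of the ordering
  grow exponentially in \<open>r\<close>: black edges at a bag of size at least \<open>s\<close> reach fewer than \<open>s\<close>
  vertices because there is no \<open>K\<^sub>s\<^sub>,\<^sub>s\<close>, and red edges stay in the window of radius
  \<open>k (r + 1)\<close>. But that window has only \<open>2 k r + 1\<close> bags, hence at most
  \<open>2 m (2 k r + 1)\<close> vertices.
\<close>

subsection \<open>Isomorphism classes\<close>

lemma isomorphic_trans:
  assumes "isomorphic G H" "isomorphic H K"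
  shows "isomorphic G K"
proof -
  obtain f where f: "bij_betw f (verts G) (verts H)" "edges H = (`) f ` edges G"
    using assms(1) by (auto simp: isomorphic_def)
  obtain g where g: "bij_betw g (verts H) (verts K)" "edges K = (`) g ` edges H"
    using assms(2) by (auto simp: isomorphic_def)
  have "bij_betw (g \<circ> f) (verts G) (verts K)"
    using f(1) g(1) by (rule bij_betw_trans)
  moreover have "edges K = (`) (g \<circ> f) ` edges G"
    by (simp add: f(2) g(2) image_image image_comp)
  ultimately show ?thesis unfolding isomorphic_def by blast
qed

text \<open>Edges of a simple graph are sets of vertices, on which the inverse undoes an injective
  \<open>f\<close>; this is what inverts relabellings below.\<close>

lemma inv_into_image_edges:
  assumes "simple_graph G" "inj_on f (verts G)"
  shows "(`) (inv_into (verts G) f) ` (`) f ` edges G = edges G"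
proof -
  have "inv_into (verts G) f ` f ` e = e" if "e \<in> edges G" for e
  proof (rule inv_into_image_cancel[OF assms(2)])
    show "e \<subseteq> verts G" using that assms(1) by (auto simp: simple_graph_def nsets_def)
  qed
  then show ?thesis by (simp add: image_image)
qed

lemma isomorphic_sym:
  assumes "simple_graph G" "isomorphic G H"
  shows "isomorphic H G"
proof -
  obtain f where f: "bij_betw f (verts G) (verts H)" "edges H = (`) f ` edges G"
    using assms(2) by (auto simp: isomorphic_def)
  have "edges G = (`) (inv_into (verts G) f) ` edges H"
    unfolding f(2) using inv_into_image_edges[OF assms(1) bij_betw_imp_inj_on[OF f(1)]] by simp
  then show ?thesis
    using bij_betw_inv_into[OF f(1)] unfolding isomorphic_def by blast
qed

lemma isomorphic_if_common_image:
  assumes H: "simple_graph H"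
    and f: "bij_betw f (verts G) X" and g: "bij_betw g (verts H) X"
    and eq: "(`) f ` edges G = (`) g ` edges H"
  shows "isomorphic G H"
proof -
  have "edges H = (`) (inv_into (verts H) g) ` (`) f ` edges G"
    unfolding eq using inv_into_image_edges[OF H bij_betw_imp_inj_on[OF g]] by simp
  also have "\<dots> = (`) (inv_into (verts H) g \<circ> f) ` edges G"
    by (simp add: image_image image_comp)
  finally show ?thesis
    using bij_betw_trans[OF f bij_betw_inv_into[OF g]] unfolding isomorphic_def by blast
qed

text \<open>Relabelling each graph by an initial segment of the naturals encodes it in a finite set,
  and graphs with equal codes are isomorphic, so there are at most as many isomorphism classes as
  codes.\<close>

lemma not_infinite_class_if_bounded:
  fixes \<G> :: "'a graph set"
  assumes simple: "\<And>G. G \<in> \<G> \<Longrightarrow> simple_graph G"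
    and bound: "\<And>G. G \<in> \<G> \<Longrightarrow> card (verts G) \<le> N"
  shows "\<not> infinite_class \<G>"
proof -
  define f where "f G = (SOME h. bij_betw h (verts G) {..<card (verts G)})" for G :: "'a graph"
  have f: "bij_betw (f G) (verts G) {..<card (verts G)}" if "G \<in> \<G>" for G
  proof -
    have "\<exists>h. bij_betw h (verts G) {..<card (verts G)}"
      using simple[OF that] ex_bij_betw_finite_nat[of "verts G"]
      by (auto simp: simple_graph_def atLeast0LessThan)
    then show ?thesis unfolding f_def by (rule someI_ex)
  qed
  \<comment> \<open>The vertex count is recorded because isolated vertices leave no trace in the
    edge set.\<close>
  define code where "code G = (card (verts G), (`) (f G) ` edges G)" for G
  have "code G \<in> {..N} \<times> Pow (Pow {..<N})" if "G \<in> \<G>" for G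
  proof -
    have "f G ` e \<subseteq> {..<N}" if e: "e \<in> edges G" for e
    proof -
      have "e \<subseteq> verts G"
        using e simple[OF \<open>G \<in> \<G>\<close>] by (auto simp: simple_graph_def nsets_def)
      then have "f G ` e \<subseteq> {..<card (verts G)}"
        using f[OF \<open>G \<in> \<G>\<close>] by (auto simp: bij_betw_def)
      then show ?thesis using bound[OF \<open>G \<in> \<G>\<close>] by auto
    qed
    then show ?thesis using bound[OF that] by (auto simp: code_def)
  qed
  then have "code ` \<G> \<subseteq> {..N} \<times> Pow (Pow {..<N})" by blast
  then have fin: "finite (code ` \<G>)" by (rule finite_subset) simp
  have "iso_rel \<G> `` {G} = iso_rel \<G> `` {H}" if "G \<in> \<G>" "H \<in> \<G>" "code G = code H" for G H
  proof -
    have "isomorphic G H"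
      using isomorphic_if_common_image[OF simple[OF that(2)] f[OF that(1)]] f[OF that(2)] that(3)
      by (auto simp: code_def)
    then show ?thesis
      using isomorphic_trans isomorphic_sym[OF simple[OF that(1)]] that(1,2)
      by (auto simp: iso_rel_def)
  qed
  \<comment> \<open>The class of a graph depends on its code alone: any chosen preimage of the code
    represents it.\<close>
  then have "iso_rel \<G> `` {G} = iso_rel \<G> `` {inv_into \<G> code (code G)}" if "G \<in> \<G>" for G
    using that by (metis f_inv_into_f image_eqI inv_into_into)
  then have "\<G> // iso_rel \<G> \<subseteq> (\<lambda>c. iso_rel \<G> `` {inv_into \<G> code c}) ` code ` \<G>"
    by (auto simp: quotient_def)
  then show ?thesis
    unfolding infinite_class_def not_not by (rule finite_subset) (simp add: fin)
qed

subsection \<open>Optimal orderings and reduction sequences\<close>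

text \<open>Every ordering has width at most its length, so \<open>LEAST\<close> ranges over a
  nonempty set of candidates.\<close>

lemma bandwidth_attained:
  assumes "finite (verts G)"
  obtains vs where "distinct vs" "set vs = verts G" "ordering_width_le G vs (bandwidth G)"
proof -
  obtain vs where vs: "set vs = verts G" "distinct vs"
    using finite_distinct_list[OF assms] by blast
  then have "ordering_width_le G vs (length vs)"
    by (auto simp: ordering_width_le_def)
  then have "\<exists>k vs. distinct vs \<and> set vs = verts G \<and> ordering_width_le G vs k"
    using vs by blast
  from LeastI_ex[OF this] show thesis
    using that unfolding bandwidth_def by blast
qed

lemma reduced_bandwidth_attained:
  assumes "simple_graph G" "verts G \<noteq> {}"
  obtains Gs where "reduction_sequence (trigraph_of G) Gs"
    "\<forall>i\<in>{1..card (verts G)}. bandwidth (red_graph (Gs i)) \<le> reduced_bandwidth G"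
proof -
  obtain Gs where Gs: "reduction_sequence (trigraph_of G) Gs"
    using ex_reduction_sequence[OF wf_trigraph_of[OF assms(1)]] assms(2)
    by (auto simp: trigraph_of_def)
  have "\<forall>i\<in>{1..card (verts G)}. bandwidth (red_graph (Gs i))
      \<le> Max ((\<lambda>i. bandwidth (red_graph (Gs i))) ` {1..card (verts G)})"
    by auto
  then have "\<exists>k Gs. reduction_sequence (trigraph_of G) Gs \<and>
      (\<forall>i\<in>{1..card (verts G)}. bandwidth (red_graph (Gs i)) \<le> k)"
    using Gs by blast
  from LeastI_ex[OF this] show thesis
    using that unfolding reduced_bandwidth_def by blast
qed

subsection \<open>Bags\<close>

text \<open>The invariant that carries a trigraph back to \<open>G\<close>; red pairs impose no
  condition. The bags are asked to cover the vertices, and all later counts go by inclusion and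
  subadditivity.\<close>

definition bags :: "'a graph \<Rightarrow> 'a trigraph \<Rightarrow> ('a \<Rightarrow> 'a set) \<Rightarrow> bool" where
  "bags G T B \<longleftrightarrow>
     (\<Union>x\<in>tverts T. B x) = verts G \<and>
     (\<forall>x\<in>tverts T. \<forall>y\<in>tverts T. x \<noteq> y \<longrightarrow>
        ({x, y} \<in> black T \<longrightarrow> (\<forall>a\<in>B x. \<forall>b\<in>B y. {a, b} \<in> edges G)) \<and>
        ({x, y} \<notin> black T \<union> red T \<longrightarrow> (\<forall>a\<in>B x. \<forall>b\<in>B y. {a, b} \<notin> edges G)))"

lemma bags_black:
  assumes "bags G T B" "x \<in> tverts T" "y \<in> tverts T" "x \<noteq> y" "{x, y} \<in> black T"
    "a \<in> B x" "b \<in> B y"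
  shows "{a, b} \<in> edges G"
  using assms by (auto simp: bags_def)

lemma bags_nonedge:
  assumes "bags G T B" "x \<in> tverts T" "y \<in> tverts T" "x \<noteq> y" "{x, y} \<notin> black T \<union> red T"
    "a \<in> B x" "b \<in> B y"
  shows "{a, b} \<notin> edges G"
  using assms unfolding bags_def by blast

lemma bags_trigraph_of: "bags G (trigraph_of G) (\<lambda>x. {x})"
  by (auto simp: bags_def trigraph_of_def)

text \<open>A pair at \<open>w\<close> is black, or a non-edge, only if both of its predecessors
  are, so either condition passes to the union of the two bags. Entries of \<open>B\<close> at
  \<open>u\<close> or \<open>v\<close> that are not overwritten lie outside the new vertex
  set.\<close>

lemma bags_contract:
  assumes B: "bags G T B" and uv: "u \<in> tverts T" "v \<in> tverts T" "u \<noteq> v"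
    and w: "w \<notin> tverts T - {u, v}"
  shows "bags G (contract T u v w) (B(w := B u \<union> B v))"
proof -
  define X where "X = tverts T - {u, v}"
  define T' where "T' = contract T u v w"
  define B' where "B' = B(w := B u \<union> B v)"
  have wX: "w \<notin> X" using w by (simp add: X_def)
  have tv: "tverts T' = insert w X"
    by (simp add: T'_def contract_def Let_def X_def)
  have bl: "black T' = (black T \<inter> nsets X 2)
         \<union> {{w, x} | x. x \<in> X \<and> {u, x} \<in> black T \<and> {v, x} \<in> black T}"
    by (simp add: T'_def contract_def Let_def X_def)
  have rd: "red T' = (red T \<inter> nsets X 2)
         \<union> {{w, x} | x. x \<in> X \<and> \<not> ({u, x} \<in> black T \<and> {v, x} \<in> black T)
              \<and> \<not> ({u, x} \<notin> black T \<union> red T \<and> {v, x} \<notin> black T \<union> red T)}"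
    by (simp add: T'_def contract_def Let_def X_def)
  have sep: "{w, x} \<notin> nsets X 2" for x
    using wX by (auto simp: nsets_def)
  have oldb: "{x, y} \<in> black T' \<longleftrightarrow> {x, y} \<in> black T"
    and oldr: "{x, y} \<in> red T' \<longleftrightarrow> {x, y} \<in> red T"
    if "x \<in> X" "y \<in> X" "x \<noteq> y" for x y
  proof -
    have n: "{x, y} \<in> nsets X 2" using that by (auto simp: nsets_def)
    have "{x, y} \<noteq> {w, z}" for z using that wX by (auto simp: doubleton_eq_iff)
    then show "{x, y} \<in> black T' \<longleftrightarrow> {x, y} \<in> black T"
      and "{x, y} \<in> red T' \<longleftrightarrow> {x, y} \<in> red T" unfolding bl rd using n by blast+
  qed
  have newb: "{w, x} \<in> black T' \<longleftrightarrow> {u, x} \<in> black T \<and> {v, x} \<in> black T"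
    and newr: "{w, x} \<notin> black T' \<union> red T' \<longleftrightarrow>
      {u, x} \<notin> black T \<union> red T \<and> {v, x} \<notin> black T \<union> red T"
    if "x \<in> X" for x
    using that sep unfolding bl rd by (auto simp: doubleton_eq_iff)
  have B'X: "B' x = B x" if "x \<in> X" for x using that wX by (auto simp: B'_def)
  have B'w: "B' w = B u \<union> B v" by (simp add: B'_def)
  note bb = bags_black[OF B] and bn = bags_nonedge[OF B]
  have XT: "x \<in> tverts T" "x \<noteq> u" "x \<noteq> v" if "x \<in> X" for x using that by (auto simp: X_def)
  have new: "({w, x} \<in> black T' \<longrightarrow> (\<forall>a\<in>B' w. \<forall>b\<in>B' x. {a, b} \<in> edges G)) \<and>
      ({w, x} \<notin> black T' \<union> red T' \<longrightarrow> (\<forall>a\<in>B' w. \<forall>b\<in>B' x. {a, b} \<notin> edges G))"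
    if x: "x \<in> X" for x
  proof (intro conjI impI ballI)
    fix a b assume "{w, x} \<in> black T'" and a: "a \<in> B' w" and b: "b \<in> B' x"
    then have "{u, x} \<in> black T" "{v, x} \<in> black T" using newb[OF x] by auto
    then show "{a, b} \<in> edges G"
      using a b bb[OF uv(1) XT(1)[OF x]] bb[OF uv(2) XT(1)[OF x]] XT[OF x] B'X[OF x] B'w by auto
  next
    fix a b assume "{w, x} \<notin> black T' \<union> red T'" and a: "a \<in> B' w" and b: "b \<in> B' x"
    then have "{u, x} \<notin> black T \<union> red T" "{v, x} \<notin> black T \<union> red T" using newr[OF x] by auto
    then show "{a, b} \<notin> edges G"
      using a b bn[OF uv(1) XT(1)[OF x]] bn[OF uv(2) XT(1)[OF x]] XT[OF x] B'X[OF x] B'w by auto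
  qed
  have "(\<Union>x\<in>tverts T'. B' x) = B u \<union> B v \<union> (\<Union>x\<in>X. B x)"
    using B'X B'w by (simp add: tv)
  also have "\<dots> = (\<Union>x\<in>tverts T. B x)" using uv by (auto simp: X_def)
  also have "\<dots> = verts G" using B by (simp add: bags_def)
  finally have un: "(\<Union>x\<in>tverts T'. B' x) = verts G" .
  have "({x, y} \<in> black T' \<longrightarrow> (\<forall>a\<in>B' x. \<forall>b\<in>B' y. {a, b} \<in> edges G)) \<and>
      ({x, y} \<notin> black T' \<union> red T' \<longrightarrow> (\<forall>a\<in>B' x. \<forall>b\<in>B' y. {a, b} \<notin> edges G))"
    if xy: "x \<in> insert w X" "y \<in> insert w X" "x \<noteq> y" for x y
  proof -
    consider "x = w" "y \<in> X" | "y = w" "x \<in> X" | "x \<in> X" "y \<in> X" using xy by blast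
    then show ?thesis
    proof cases
      case 1
      then show ?thesis using new by blast
    next
      case 2
      \<comment> \<open>\<open>bags\<close> speaks of ordered pairs; reversing both the pair of bags
        and the pair of vertices reduces this case to \<open>new\<close>.\<close>
      have swap: "{b, a} = {a, b}" for a b :: 'a by (rule insert_commute)
      show ?thesis using new[OF 2(2)] unfolding 2(1) swap[of x w]
        by (metis swap)
    next
      case 3
      note xyT = XT(1)[OF 3(1)] XT(1)[OF 3(2)] xy(3)
      show ?thesis
        unfolding Un_iff oldb[OF 3 xy(3)] oldr[OF 3 xy(3)] B'X[OF 3(1)] B'X[OF 3(2)]
        using bb[OF xyT] bn[OF xyT] by simp
    qed
  qed
  then show ?thesis
    using un unfolding bags_def T'_def[symmetric] B'_def[symmetric] tv by simp
qed

text \<open>Bags start as singletons, one contraction at most doubles the bound on their sizes, and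
  the last bag is all of \<open>verts G\<close>. So the sizes must reach \<open>m\<close>, and when
  they first do they are still at most \<open>2 * m\<close>.\<close>

lemma ex_bags_with_large_bag:
  assumes seq: "reduction_sequence (trigraph_of G) Gs"
    and m: "2 \<le> m" "m \<le> card (verts G)"
  shows "\<exists>i\<in>{1..card (verts G)}. \<exists>B. bags G (Gs i) B \<and>
    (\<exists>x\<in>tverts (Gs i). m \<le> card (B x)) \<and> (\<forall>x\<in>tverts (Gs i). card (B x) \<le> 2 * m)"
    (is "\<exists>i\<in>_. ?hit i")
proof (rule ccontr)
  assume no: "\<not> (\<exists>i\<in>{1..card (verts G)}. ?hit i)"
  define n where "n = card (verts G)"
  have n: "card (tverts (trigraph_of G)) = n" by (simp add: n_def trigraph_of_def)
  have start: "Gs n = trigraph_of G"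
    and step: "\<And>i. i \<in> {2..n} \<Longrightarrow> contraction (Gs i) (Gs (i - 1))"
    and last: "card (tverts (Gs 1)) = 1"
    using seq by (auto simp: reduction_sequence_def n)
  have "1 \<le> n" using m by (simp add: n_def)
  \<comment> \<open>If no index is a hit, sizes below \<open>m\<close> persist from index
    \<open>n\<close> down to 1. They hold at the start because singletons have size 1 and
    \<open>2 \<le> m\<close>.\<close>
  then have "\<exists>B. bags G (Gs 1) B \<and> (\<forall>x\<in>tverts (Gs 1). card (B x) < m)"
  proof (induction rule: inc_induct)
    case base
    then show ?case using bags_trigraph_of m(1) by (auto simp: start intro!: exI[of _ "\<lambda>x. {x}"])
  next
    case (step i)
    obtain B where B: "bags G (Gs (Suc i)) B" "\<forall>x\<in>tverts (Gs (Suc i)). card (B x) < m"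
      using step.IH by blast
    have "contraction (Gs (Suc i)) (Gs i)"
      using \<open>\<And>i. i \<in> {2..n} \<Longrightarrow> contraction (Gs i) (Gs (i - 1))\<close>[of "Suc i"] step.hyps by auto
    then obtain u v w where uv: "u \<in> tverts (Gs (Suc i))" "v \<in> tverts (Gs (Suc i))" "u \<noteq> v"
      "w \<notin> tverts (Gs (Suc i)) - {u, v}" and Gi: "Gs i = contract (Gs (Suc i)) u v w"
      by (auto simp: contraction_def)
    define B' where "B' = B(w := B u \<union> B v)"
    have B': "bags G (Gs i) B'"
      using bags_contract[OF B(1) uv] by (simp add: Gi B'_def)
    have "tverts (Gs i) = insert w (tverts (Gs (Suc i)) - {u, v})"
      by (simp add: Gi contract_def Let_def)
    moreover have "card (B u \<union> B v) \<le> 2 * m"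
      using card_Un_le[of "B u" "B v"] bspec[OF B(2) uv(1)] bspec[OF B(2) uv(2)] by linarith
    ultimately have "\<forall>x\<in>tverts (Gs i). card (B' x) \<le> 2 * m"
      using B(2) by (fastforce simp: B'_def)
    moreover have "i \<in> {1..card (verts G)}" using step.hyps by (auto simp: n_def)
    \<comment> \<open>All sizes are at most \<open>2 * m\<close> here, so a bag of size
      \<open>m\<close> or more would make \<open>i\<close> a hit.\<close>
    ultimately have "\<forall>x\<in>tverts (Gs i). card (B' x) < m"
      using no B' by (meson leI)
    then show ?case using B' by blast
  qed
  then obtain B where B: "bags G (Gs 1) B" "\<forall>x\<in>tverts (Gs 1). card (B x) < m" by blast
  obtain x where "tverts (Gs 1) = {x}" using last by (auto simp: card_1_singleton_iff)
  then show False using B m(2) by (auto simp: bags_def)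
qed

subsection \<open>Expansion\<close>

text \<open>Otherwise \<open>s\<close> vertices of \<open>A\<close> and \<open>s\<close> common
  neighbours would span a K_{s,s}; the two sides are disjoint because a simple graph has no
  loops.\<close>

lemma card_common_neighbours_less:
  assumes G: "simple_graph G" "\<not> contains_Kss G s"
    and A: "A \<subseteq> verts G" "s \<le> card A"
  shows "card {v \<in> verts G. \<forall>u\<in>A. {u, v} \<in> edges G} < s"
proof (rule ccontr)
  let ?C = "{v \<in> verts G. \<forall>u\<in>A. {u, v} \<in> edges G}"
  assume "\<not> card ?C < s"
  then obtain C where C: "C \<subseteq> ?C" "card C = s"
    by (meson not_less obtain_subset_with_card_n)
  obtain A' where A': "A' \<subseteq> A" "card A' = s"
    using A(2) obtain_subset_with_card_n by metis
  have "{x, x} \<notin> edges G" for x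
    using G(1) by (auto simp: simple_graph_def nsets_def)
  moreover have "{x, x} \<in> edges G" if "x \<in> A'" "x \<in> C" for x
    using that A'(1) C(1) by blast
  ultimately have "A' \<inter> C = {}" by blast
  moreover have "A' \<subseteq> verts G" "C \<subseteq> verts G" "\<forall>a\<in>A'. \<forall>b\<in>C. {a, b} \<in> edges G"
    using A(1) A'(1) C(1) by auto
  ultimately have "contains_Kss G s"
    unfolding contains_Kss_def using A'(2) C(2) by metis
  then show False using G(2) by contradiction
qed

section \<open>Growth over windows of an ordering\<close>

text \<open>Positions in an ordering of length \<open>M\<close>, not vertices. The radius is a
  multiple of \<open>k\<close> so that following one red edge costs one step of \<open>r\<close>;
  integers avoid truncated subtraction.\<close>

definition window :: "nat \<Rightarrow> nat \<Rightarrow> nat \<Rightarrow> nat \<Rightarrow> nat set" where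
  "window M p k r = {j. j < M \<and> \<bar>int j - int p\<bar> \<le> int (k * r)}"

lemma finite_window: "finite (window M p k r)"
  by (simp add: window_def)

lemma window_Suc_mono: "window M p k r \<subseteq> window M p k (Suc r)"
  by (auto simp: window_def)

lemma card_window_le: "card (window M p k r) \<le> 2 * k * r + 1"
proof -
  \<comment> \<open>Truncation of \<open>p - k * r\<close> at 0 can only shorten the
    interval.\<close>
  have "window M p k r \<subseteq> {p - k * r..p + k * r}"
    unfolding window_def by (auto simp del: of_nat_mult)
  then have "card (window M p k r) \<le> card {p - k * r..p + k * r}"
    by (rule card_mono[rotated]) simp
  also have "\<dots> \<le> 2 * k * r + 1" by simp
  finally show ?thesis .
qed

lemma card_UN_le_mult:
  assumes "finite I" "card I \<le> w" "\<And>i. i \<in> I \<Longrightarrow> card (A i) \<le> c"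
  shows "card (\<Union>i\<in>I. A i) \<le> w * c"
proof -
  have "card (\<Union>i\<in>I. A i) \<le> (\<Sum>i\<in>I. card (A i))" by (rule card_UN_le[OF assms(1)])
  also have "\<dots> \<le> card I * c" using sum_bounded_above[of I "\<lambda>i. card (A i)" c] assms(3) by simp
  also have "\<dots> \<le> w * c" using assms(2) by simp
  finally show ?thesis .
qed

text \<open>A neighbour of \<open>S r\<close> outside \<open>S (Suc r)\<close> is a common neighbour
  of a bag of size at least \<open>s\<close>, or lies in a bag of size below \<open>s\<close>. Each
  kind contributes at most \<open>s\<close> vertices per bag of a window, which gives the subtracted
  error.\<close>

lemma window_growth:
  fixes G :: "'a graph" and p :: nat
  assumes G: "simple_graph G" "expander s \<beta> G"
    and B: "bags G T B" and vs: "set vs = tverts T" "ordering_width_le (red_graph T) vs k"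
  defines "S \<equiv> \<lambda>r. \<Union>j\<in>{j \<in> window (length vs) p k r. s \<le> card (B (vs ! j))}. B (vs ! j)"
  assumes half: "real (card (S r)) \<le> real (card (verts G)) / 2"
  shows "(1 + \<beta>) * real (card (S r)) - 2 * s * (2 * k * Suc r + 1) \<le> real (card (S (Suc r)))"
proof -
  let ?b = "\<lambda>j. B (vs ! j)"
  let ?W = "\<lambda>r. window (length vs) p k r"
  define w where "w = 2 * k * Suc r + 1"
  have fin: "finite (verts G)" using G(1) by (simp add: simple_graph_def)
  have nK: "\<not> contains_Kss G s" using G(2) by (simp add: expander_def)
  have un: "(\<Union>x\<in>set vs. B x) = verts G" using B by (simp add: bags_def vs)
  have sub: "?b j \<subseteq> verts G" if "j < length vs" for j
    using un nth_mem[OF that] by blast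
  have SV: "S r' \<subseteq> verts G" for r'
    using sub by (auto simp: S_def window_def)
  define C where "C j = {v \<in> verts G. \<forall>u\<in>?b j. {u, v} \<in> edges G}" for j
  \<comment> \<open>\<open>J1\<close> contains what black edges reach from the large bags,
    \<open>J2\<close> what lies in bags of the wider window too small to count in
    \<open>S (Suc r)\<close>.\<close>
  define J1 where "J1 = (\<Union>j\<in>{j \<in> ?W r. s \<le> card (?b j)}. C j)"
  define J2 where "J2 = (\<Union>j\<in>{j \<in> ?W (Suc r). card (?b j) < s}. ?b j)"
  have cw: "card {j \<in> ?W r. P j} \<le> w" "card {j \<in> ?W (Suc r). P j} \<le> w" for P
  proof -
    have "card {j \<in> ?W (Suc r). P j} \<le> card (?W (Suc r))"
      by (rule card_mono) (auto simp: finite_window)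
    then show 2: "card {j \<in> ?W (Suc r). P j} \<le> w"
      using card_window_le[of "length vs" p k "Suc r"] by (simp add: w_def)
    have "card {j \<in> ?W r. P j} \<le> card {j \<in> ?W (Suc r). P j}"
      using window_Suc_mono by (intro card_mono) (auto simp: finite_window subset_iff)
    with 2 show "card {j \<in> ?W r. P j} \<le> w" by simp
  qed
  have J1: "card J1 \<le> w * s" unfolding J1_def
  proof (rule card_UN_le_mult[OF _ cw(1)])
    fix j assume "j \<in> {j \<in> ?W r. s \<le> card (?b j)}"
    then have "j < length vs" "s \<le> card (?b j)" by (auto simp: window_def)
    then show "card (C j) \<le> s"
      using card_common_neighbours_less[OF G(1) nK sub] by (simp add: C_def less_imp_le)
  qed (simp add: finite_window)
  have J2: "card J2 \<le> w * s" unfolding J2_def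
    by (rule card_UN_le_mult[OF _ cw(2)]) (auto simp: finite_window)
  have SS: "S r \<subseteq> S (Suc r)"
    unfolding S_def by (rule UN_mono) (use window_Suc_mono in blast)+
  have N: "neighbours G (S r) \<subseteq> (S (Suc r) - S r) \<union> (J1 \<union> J2)"
  proof
    fix v assume "v \<in> neighbours G (S r)"
    then obtain u where v: "v \<in> verts G" "v \<notin> S r" and u: "u \<in> S r" "{u, v} \<in> edges G"
      by (auto simp: neighbours_def)
    obtain j where j: "j \<in> ?W r" "s \<le> card (?b j)" "u \<in> ?b j"
      using u(1) unfolding S_def by blast
    have jl: "j < length vs" using j(1) by (simp add: window_def)
    obtain y where y: "y \<in> set vs" "v \<in> B y"
      using v(1) unfolding un[symmetric] by (rule UN_E)
    then obtain j' where j': "j' < length vs" "v \<in> ?b j'"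
      by (auto simp: in_set_conv_nth)
    \<comment> \<open>\<open>S r\<close> is a union of whole bags, so a vertex outside it cannot
      share the bag of \<open>u\<close>.\<close>
    have ne: "vs ! j \<noteq> vs ! j'"
    proof
      assume "vs ! j = vs ! j'"
      then have "v \<in> S r" unfolding S_def using j(1,2) j'(2) by auto
      then show False using v(2) by contradiction
    qed
    have vT: "vs ! j \<in> tverts T" "vs ! j' \<in> tverts T"
      unfolding vs(1)[symmetric] by (rule nth_mem[OF jl], rule nth_mem[OF j'(1)])
    have "{vs ! j, vs ! j'} \<in> black T \<union> red T"
      using bags_nonedge[OF B vT ne _ j(3) j'(2)] u(2) by argo
    then consider "{vs ! j, vs ! j'} \<in> black T" | "{vs ! j, vs ! j'} \<in> red T" by blast
    then show "v \<in> (S (Suc r) - S r) \<union> (J1 \<union> J2)"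
    proof cases
      case 1
      \<comment> \<open>A black pair joins \<open>v\<close> to the whole bag, not just to
        \<open>u\<close>.\<close>
      then have "\<forall>u\<in>?b j. {u, v} \<in> edges G"
        using bags_black[OF B vT ne _ _ j'(2)] by simp
      then have "v \<in> C j" using v(1) by (simp add: C_def)
      then have "v \<in> J1" unfolding J1_def using j(1,2) by blast
      then show ?thesis by simp
    next
      case 2
      then have "\<bar>int j - int j'\<bar> \<le> int k"
        using vs(2) jl j'(1) by (simp add: ordering_width_le_def red_graph_def)
      then have "j' \<in> ?W (Suc r)"
        using j(1) j'(1) by (auto simp: window_def)
      then have "v \<in> S (Suc r) \<union> J2"
        unfolding S_def J2_def using j'(2) by (cases "s \<le> card (?b j')") auto
      then show ?thesis using v(2) by blast
    qed
  qed
  have finS: "finite (S r')" for r' using SV fin finite_subset by blast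
  have finJ: "finite J1" "finite J2"
    using finite_subset[OF sub fin] fin
    by (auto simp: J1_def J2_def C_def finite_window window_def)
  have "card (neighbours G (S r)) \<le> card ((S (Suc r) - S r) \<union> (J1 \<union> J2))"
    using N finS finJ by (intro card_mono) auto
  also have "\<dots> \<le> card (S (Suc r) - S r) + (card J1 + card J2)"
    using card_Un_le[of "S (Suc r) - S r" "J1 \<union> J2"] card_Un_le[of J1 J2] by linarith
  also have "\<dots> \<le> card (S (Suc r) - S r) + 2 * (w * s)" using J1 J2 by simp
  \<comment> \<open>Since \<open>S r\<close> is contained in \<open>S (Suc r)\<close>, the sizes
    subtract exactly and the neighbour count becomes growth.\<close>
  finally have "card (S r) + card (neighbours G (S r)) \<le> card (S (Suc r)) + 2 * (w * s)"
    using card_Diff_subset[OF finS SS] card_mono[OF finS SS] by linarith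
  then have "real (card (S r)) + real (card (neighbours G (S r)))
      \<le> real (card (S (Suc r))) + real (2 * (w * s))"
    by (simp only: of_nat_le_iff flip: of_nat_add)
  moreover have "\<beta> * real (card (S r)) \<le> real (card (neighbours G (S r)))"
    using G(2) SV half by (auto simp: expander_def)
  ultimately show ?thesis by (simp add: w_def algebra_simps)
qed

section \<open>Exponential growth against linear window size\<close>

text \<open>Here \<open>w\<close> bounds the number of bags in every window used. The third
  condition on \<open>m\<close> lets half of the expansion pay for the error, leaving growth by
  \<open>1 + \<beta> / 2\<close>; having \<open>4 * w * m\<close> vertices keeps each union within
  half of \<open>G\<close>; and at \<open>R\<close> the growth overtakes the capacity
  \<open>w * (2 * m)\<close>.\<close>

lemma no_narrow_reduction_sequence:
  fixes G :: "'a graph" and k s R m :: nat and \<beta> :: real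
  defines "w \<equiv> 2 * k * R + 1"
  assumes \<beta>: "\<beta> > 0" and G: "simple_graph G" "expander s \<beta> G"
    and R: "2 * real w < (1 + \<beta> / 2) ^ R"
    and m: "2 \<le> m" "s \<le> m" "4 * s * w \<le> \<beta> * m"
    and n: "4 * w * m \<le> card (verts G)"
    and seq: "reduction_sequence (trigraph_of G) Gs"
    and bw: "\<forall>i\<in>{1..card (verts G)}. bandwidth (red_graph (Gs i)) \<le> k"
  shows False
proof -
  have "m \<le> 4 * w * m" by (simp add: w_def)
  then have "m \<le> card (verts G)" using n by linarith
  from ex_bags_with_large_bag[OF seq m(1) this] obtain i B x where i: "i \<in> {1..card (verts G)}"
    and B: "bags G (Gs i) B" "x \<in> tverts (Gs i)" "m \<le> card (B x)"
      "\<forall>x\<in>tverts (Gs i). card (B x) \<le> 2 * m" by blast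
  \<comment> \<open>Well-formedness descends along the sequence; it makes the vertex set finite, so
    that an optimal ordering exists.\<close>
  have "i \<le> card (verts G)" using i by simp
  then have "wf_trigraph (Gs i)"
  proof (induction rule: inc_induct)
    case base
    then show ?case using seq wf_trigraph_of[OF G(1)]
      by (simp add: reduction_sequence_def trigraph_of_def)
  next
    case (step j)
    then have "Suc j \<in> {2..card (tverts (trigraph_of G))}"
      using i by (auto simp: trigraph_of_def)
    then have "contraction (Gs (Suc j)) (Gs j)"
      using seq unfolding reduction_sequence_def by (metis diff_Suc_1)
    then show ?case using wf_contraction step.IH by blast
  qed
  then have "finite (verts (red_graph (Gs i)))" by (simp add: red_graph_def wf_trigraph_def)
  then obtain vs where vs: "set vs = verts (red_graph (Gs i))"
      "ordering_width_le (red_graph (Gs i)) vs (bandwidth (red_graph (Gs i)))"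
    using bandwidth_attained by metis
  have vs1: "set vs = tverts (Gs i)" using vs(1) by (simp add: red_graph_def)
  have vs2: "ordering_width_le (red_graph (Gs i)) vs k"
    using vs(2) bw i by (fastforce simp: ordering_width_le_def)
  obtain p where p: "p < length vs" "vs ! p = x"
    using B(2) vs1 by (metis in_set_conv_nth)
  define S where "S r = (\<Union>j\<in>{j \<in> window (length vs) p k r. s \<le> card (B (vs ! j))}. B (vs ! j))"
    for r
  have fin: "finite (verts G)" using G(1) by (simp add: simple_graph_def)
  have upper: "card (S r) \<le> w * (2 * m)" if "r \<le> R" for r
    unfolding S_def
  proof (rule card_UN_le_mult)
    have "card {j \<in> window (length vs) p k r. s \<le> card (B (vs ! j))} \<le> card (window (length vs) p k r)"
      by (rule card_mono) (auto simp: finite_window)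
    also have "\<dots> \<le> 2 * k * r + 1" by (rule card_window_le)
    also have "\<dots> \<le> w" using that by (simp add: w_def)
    finally show "card {j \<in> window (length vs) p k r. s \<le> card (B (vs ! j))} \<le> w" .
  qed (use B(4) vs1 in \<open>auto simp: finite_window window_def\<close>)
  have lower: "(1 + \<beta> / 2) ^ r * m \<le> card (S r)" if "r \<le> R" for r
    using that
  proof (induction r)
    case 0
    \<comment> \<open>The window of radius 0 is \<open>p\<close> alone, and its bag counts because
      \<open>s \<le> m\<close>.\<close>
    have "p \<in> {j \<in> window (length vs) p k 0. s \<le> card (B (vs ! j))}"
      using p B(3) m(2) by (simp add: window_def)
    then have "B x \<subseteq> S 0" unfolding S_def using p(2) by blast
    moreover have "S 0 \<subseteq> (\<Union>x\<in>set vs. B x)"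
      unfolding S_def window_def by (auto intro: nth_mem)
    then have "S 0 \<subseteq> verts G"
      using B(1) vs1 by (simp add: bags_def)
    ultimately have "card (B x) \<le> card (S 0)" using fin by (meson card_mono finite_subset)
    then show ?case using B(3) by simp
  next
    case (Suc r)
    \<comment> \<open>Twice the bound \<open>w * (2 * m)\<close> is at most the order of
      \<open>G\<close>, so expansion applies to \<open>S r\<close>.\<close>
    have "2 * card (S r) \<le> card (verts G)" using upper[of r] Suc.prems n by simp
    then have half: "real (card (S r)) \<le> real (card (verts G)) / 2" by linarith
    \<comment> \<open>The error is at most \<open>\<beta> / 2 * m\<close>, and \<open>S r\<close>
      has at least \<open>m\<close> vertices by induction, so the error is at most half of the
      expansion.\<close>
    have "real (2 * s * (2 * k * Suc r + 1)) \<le> real (2 * s * w)"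
      unfolding of_nat_le_iff w_def using Suc.prems by (intro mult_left_mono add_right_mono) auto
    also have "\<dots> \<le> \<beta> / 2 * m" using m(3) by simp
    also have "\<dots> \<le> \<beta> / 2 * real (card (S r))"
    proof -
      have "1 * real m \<le> (1 + \<beta> / 2) ^ r * m"
        using \<beta> by (intro mult_right_mono one_le_power) auto
      then show ?thesis using Suc \<beta> by (intro mult_left_mono) auto
    qed
    finally have "(1 + \<beta> / 2) * real (card (S r)) \<le> card (S (Suc r))"
      using window_growth[OF G B(1) vs1 vs2, where p = p and r = r, folded S_def, OF half]
      by (simp add: algebra_simps)
    moreover have "(1 + \<beta> / 2) * ((1 + \<beta> / 2) ^ r * m) \<le> (1 + \<beta> / 2) * real (card (S r))"
      using Suc \<beta> by (intro mult_left_mono) auto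
    ultimately show ?case by (simp add: mult.assoc)
  qed
  have "2 * real w * m < (1 + \<beta> / 2) ^ R * m"
    using R m(1) by (intro mult_strict_right_mono) auto
  also have "\<dots> \<le> card (S R)" using lower by simp
  also have "\<dots> \<le> real (w * (2 * m))" using upper[of R] by (simp only: of_nat_le_iff)
  finally show False by simp
qed

section \<open>Choice of constants and conclusion\<close>

text \<open>The constants are chosen in turn: \<open>R\<close> from \<open>k\<close> and
  \<open>\<beta>\<close>, then \<open>w\<close>, then \<open>m\<close>. Above
  \<open>4 * w * m\<close> vertices the preceding contradiction applies.\<close>

lemma expander_card_bounded:
  fixes s k :: nat and \<beta> :: real
  assumes \<beta>: "\<beta> > 0"
  obtains N where "\<And>G :: 'a graph. simple_graph G \<Longrightarrow> expander s \<beta> G \<Longrightarrow>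
    reduced_bandwidth G \<le> k \<Longrightarrow> card (verts G) \<le> N"
proof -
  have "\<forall>\<^sub>F R in at_top. 2 * (2 * real k * real R + 1) < (1 + \<beta> / 2) ^ R"
    using \<beta> by real_asymp
  then obtain R where "2 * (2 * real k * real R + 1) < (1 + \<beta> / 2) ^ R"
    by (auto simp: eventually_at_top_linorder)
  then have R: "2 * real (2 * k * R + 1) < (1 + \<beta> / 2) ^ R" by simp
  define w where "w = 2 * k * R + 1"
  \<comment> \<open>The summands secure in turn \<open>2 \<le> m\<close>, \<open>s \<le> m\<close>
    and \<open>4 * s * w \<le> \<beta> * m\<close>.\<close>
  define m where "m = 2 + s + nat \<lceil>4 * s * w / \<beta>\<rceil>"
  have "4 * s * w / \<beta> \<le> m" unfolding m_def by linarith
  then have m3: "4 * s * w \<le> \<beta> * m" using \<beta> by (simp add: field_simps)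
  have "card (verts G) \<le> 4 * w * m"
    if G: "simple_graph G" "expander s \<beta> G" and k: "reduced_bandwidth G \<le> k" for G :: "'a graph"
  proof (rule ccontr)
    assume n: "\<not> card (verts G) \<le> 4 * w * m"
    then have "verts G \<noteq> {}" by auto
    then obtain Gs where Gs: "reduction_sequence (trigraph_of G) Gs"
      "\<forall>i\<in>{1..card (verts G)}. bandwidth (red_graph (Gs i)) \<le> reduced_bandwidth G"
      using reduced_bandwidth_attained[OF G(1)] by metis
    then have "\<forall>i\<in>{1..card (verts G)}. bandwidth (red_graph (Gs i)) \<le> k"
      using k le_trans by blast
    then show False
      using no_narrow_reduction_sequence[OF \<beta> G R _ _ _ _ Gs(1), of m] m3 n
      by (simp add: w_def m_def)
  qed
  then show thesis by (rule that)
qed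

theorem theorem31:
  fixes s :: nat and \<beta> :: real and \<G> :: "'a graph set"
  assumes "\<beta> > 0"
    and "\<And>G. G \<in> \<G> \<Longrightarrow> simple_graph G \<and> expander s \<beta> G"
    and "infinite_class \<G>"
  shows "\<not> bdd_above (reduced_bandwidth ` \<G>)"
proof
  assume "bdd_above (reduced_bandwidth ` \<G>)"
  then obtain k where k: "\<And>G. G \<in> \<G> \<Longrightarrow> reduced_bandwidth G \<le> k"
    by (auto simp: bdd_above_def)
  \<comment> \<open>A common \<open>k\<close> bounds the order of all members, which leaves only
    finitely many isomorphism classes.\<close>
  obtain N where "\<And>G :: 'a graph. simple_graph G \<Longrightarrow> expander s \<beta> G \<Longrightarrow>
    reduced_bandwidth G \<le> k \<Longrightarrow> card (verts G) \<le> N"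
    using expander_card_bounded[OF assms(1)] by blast
  then have "\<And>G. G \<in> \<G> \<Longrightarrow> card (verts G) \<le> N"
    using assms(2) k by blast
  then show False
    using not_infinite_class_if_bounded assms(2,3) by blast
qed

end
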